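(* Let $\lambda=1$ and let $\bar s_0\sim 1.0213$ be the unique positive zero of the function $$\varphi(s)=-\frac{s^3}{3}-9s+\left(9+6s^2-3s^4\right)\arctan(s).$$ If $s_0>\bar s_0$, set $$L_0=8\pi s_0^{5/2}\left(15\left(\frac{s_0^3}{3}+9s_0-\left(9+6s_0^2-3s_0^4\right)\arctan(s_0)\right)\right)^{-1/2}.$$ Then, for every $L>L_0$, the translating $1$-soliton $\Sigma(s_0;L)$ (with respect to the density vector $\mathbf{v}=(0,0,1)$) is unstable.
   Context: Let $\mathbf{v}=(0,0,1)$ and $\phi(x)=\langle x,\mathbf{v}\rangle=x_3$; the weighted area element is $dA_\phi=e^{x_3}dA$. An oriented immersed surface with Gauss map $N$ is a translating $\lambda$-soliton with respect to $\mathbf{v}$ if its mean curvature $H$ (sum of the principal curvatures, with sign convention $H=\mathrm{trace}(-dN)$) satisfies $H=\langle N,\mathbf{v}\rangle+\lambda$. For $\lambda=1$ consider the arc-length parametrized curve $\alpha=(\alpha_1,0,\alpha_3):\mathbb{R}\to\mathbb{R}^3$ with $\alpha_1(s)=-s+2\arctan(s)$ and $\alpha_3(s)=\log(1+s^2)$. The immersed cylindrical surface $\Psi(s,t)=(\alpha_1(s),t,\alpha_3(s))$, with Gauss map $N=(-\alpha_3',0,\alpha_1')$, is a translating $1$-soliton. For $s_0>0$ and $L>0$ let $$\Sigma(s_0;L)=\{(-s+2\arctan(s),\,t,\,\log(1+s^2)): s\in[-s_0,s_0],\ t\in[0,L]\},$$ regarded as an immersed compact surface with boundary, parametrized by $[-s_0,s_0]\times[0,L]$.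 Stability: for a smooth function $u$ on a compact translating $\lambda$-soliton $\Sigma$ vanishing on $\partial\Sigma$, the second variation of the weighted area for variations fixing the boundary with normal component $u$ is $Q_\phi(u)=-\int_\Sigma u(\Delta u+\langle\nabla u,\mathbf{v}\rangle+|A|^2u)\,dA_\phi=\int_\Sigma(|\nabla u|^2-|A|^2u^2)\,dA_\phi$, where $\Delta,\nabla$ are the Laplacian and gradient of $\Sigma$ and $A$ its second fundamental form. $\Sigma$ is stable if $Q_\phi(u)\ge0$ for all such $u$ with $\int_\Sigma u\,dA_\phi=0$ (volume preserving variations), and unstable if it is not stable, i.e. if there is such a $u$ with $u=0$ on $\partial\Sigma$, $\int_\Sigma u\,dA_\phi=0$ and $Q_\phi(u)<0$. *)

theory Defs
  imports "HOL-Analysis.Analysis"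
begin

(* Meant for open U only: the derivatives are taken in the full neighbourhood of each point. *)

fun Ck_on :: "nat \<Rightarrow> 'a set \<Rightarrow> ('a::real_normed_vector \<Rightarrow> 'b::real_normed_vector) \<Rightarrow> bool" where
  "Ck_on 0 U f \<longleftrightarrow> continuous_on U f"
| "Ck_on (Suc k) U f \<longleftrightarrow>
     (\<forall>x\<in>U. f differentiable (at x)) \<and>
     (\<forall>h. Ck_on k U (\<lambda>x. frechet_derivative f (at x) h))"

definition smooth_on :: "'a set \<Rightarrow> ('a::real_normed_vector \<Rightarrow> 'b::real_normed_vector) \<Rightarrow> bool" where
  "smooth_on U f \<longleftrightarrow> (\<forall>k. Ck_on k U f)"

(* Smoothness up to the boundary of a compact region D: f is represented by a function that is
   smooth on an open neighbourhood of D.  For D the closure of its interior, the derivatives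
   on D depend only on the values of f on D. *)
definition smooth_near :: "'a set \<Rightarrow> ('a::real_normed_vector \<Rightarrow> 'b::real_normed_vector) \<Rightarrow> bool" where
  "smooth_near D f \<longleftrightarrow> (\<exists>U. open U \<and> D \<subseteq> U \<and> smooth_on U f)"

(* Compact oriented immersed surfaces in R^3, given by one parametrization X : D -> R^3,
   D in R^2, together with a Gauss map N : D -> R^3 along X.  Objects on the surface are
   functions on D, so self-intersections of the image X ` D play no role. *)

definition coord_vec :: "2 \<Rightarrow> real \<times> real" where
  "coord_vec i = (if i = 1 then (1, 0) else (0, 1))"

definition pderivative :: "2 \<Rightarrow> (real \<times> real \<Rightarrow> 'b::real_normed_vector) \<Rightarrow> real \<times> real \<Rightarrow> 'b" where
  "pderivative i f p = frechet_derivative f (at p) (coord_vec i)"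

definition oriented_immersed_surface ::
    "(real \<times> real) set \<Rightarrow> (real \<times> real \<Rightarrow> real^3) \<Rightarrow> (real \<times> real \<Rightarrow> real^3) \<Rightarrow> bool" where
  "oriented_immersed_surface D X N \<longleftrightarrow>
     compact D \<and> D = closure (interior D) \<and> smooth_near D X \<and> smooth_near D N \<and>
     (\<forall>p\<in>D. inj (frechet_derivative X (at p)) \<and> norm (N p) = 1 \<and>
            (\<forall>i. N p \<bullet> pderivative i X p = 0))"

definition first_ff :: "(real \<times> real \<Rightarrow> real^3) \<Rightarrow> real \<times> real \<Rightarrow> real^2^2" where
  "first_ff X p = (\<chi> i j. pderivative i X p \<bullet> pderivative j X p)"

definition second_ff ::
    "(real \<times> real \<Rightarrow> real^3) \<Rightarrow> (real \<times> real \<Rightarrow> real^3) \<Rightarrow> real \<times> real \<Rightarrow> real^2^2" where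
  "second_ff X N p = (\<chi> i j. - (pderivative i X p \<bullet> pderivative j N p))"

(* Matrix of -dN in the basis of coordinate tangent vectors (column j holds the coordinates
   of -dN applied to the j-th one). *)
definition shape_op ::
    "(real \<times> real \<Rightarrow> real^3) \<Rightarrow> (real \<times> real \<Rightarrow> real^3) \<Rightarrow> real \<times> real \<Rightarrow> real^2^2" where
  "shape_op X N p = matrix_inv (first_ff X p) ** second_ff X N p"

(* sum of the principal curvatures, without the factor 1/2 *)
definition mean_curv ::
    "(real \<times> real \<Rightarrow> real^3) \<Rightarrow> (real \<times> real \<Rightarrow> real^3) \<Rightarrow> real \<times> real \<Rightarrow> real" where
  "mean_curv X N p = trace (shape_op X N p)"

(* |A|^2, the squared norm of the second fundamental form (-dN is self-adjoint) *)
definition norm_A_sq ::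
    "(real \<times> real \<Rightarrow> real^3) \<Rightarrow> (real \<times> real \<Rightarrow> real^3) \<Rightarrow> real \<times> real \<Rightarrow> real" where
  "norm_A_sq X N p = trace (shape_op X N p ** shape_op X N p)"

(* The intrinsic gradient g^{ij} u_j X_i, as a tangent vector in R^3 *)
definition surf_grad ::
    "(real \<times> real \<Rightarrow> real^3) \<Rightarrow> (real \<times> real \<Rightarrow> real) \<Rightarrow> real \<times> real \<Rightarrow> real^3" where
  "surf_grad X u p =
     (\<Sum>i\<in>UNIV. (matrix_inv (first_ff X p) *v (\<chi> j. pderivative j u p)) $ i *\<^sub>R pderivative i X p)"

(* Integral over the surface against dA_phi = e^phi dA, where phi(x) = <x,v> *)
definition weighted_integral ::
    "real^3 \<Rightarrow> (real \<times> real) set \<Rightarrow> (real \<times> real \<Rightarrow> real^3) \<Rightarrow> (real \<times> real \<Rightarrow> real) \<Rightarrow> real" where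
  "weighted_integral v D X f =
     integral D (\<lambda>p. f p * exp (X p \<bullet> v) * sqrt (det (first_ff X p)))"

definition translating_soliton ::
    "real \<Rightarrow> real^3 \<Rightarrow> (real \<times> real) set \<Rightarrow> (real \<times> real \<Rightarrow> real^3) \<Rightarrow> (real \<times> real \<Rightarrow> real^3) \<Rightarrow> bool" where
  "translating_soliton lam v D X N \<longleftrightarrow>
     oriented_immersed_surface D X N \<and> (\<forall>p\<in>D. mean_curv X N p = N p \<bullet> v + lam)"

definition Q_phi ::
    "real^3 \<Rightarrow> (real \<times> real) set \<Rightarrow> (real \<times> real \<Rightarrow> real^3) \<Rightarrow> (real \<times> real \<Rightarrow> real^3) \<Rightarrow>
     (real \<times> real \<Rightarrow> real) \<Rightarrow> real" where
  "Q_phi v D X N u =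
     weighted_integral v D X (\<lambda>p. (norm (surf_grad X u p))\<^sup>2 - norm_A_sq X N p * (u p)\<^sup>2)"

(* The boundary of the surface corresponds to the frontier of the parameter domain. *)
definition stable ::
    "real^3 \<Rightarrow> (real \<times> real) set \<Rightarrow> (real \<times> real \<Rightarrow> real^3) \<Rightarrow> (real \<times> real \<Rightarrow> real^3) \<Rightarrow> bool" where
  "stable v D X N \<longleftrightarrow>
     (\<forall>u. smooth_near D u \<and> (\<forall>p\<in>frontier D. u p = 0) \<and> weighted_integral v D X u = 0
        \<longrightarrow> Q_phi v D X N u \<ge> 0)"

definition unstable ::
    "real^3 \<Rightarrow> (real \<times> real) set \<Rightarrow> (real \<times> real \<Rightarrow> real^3) \<Rightarrow> (real \<times> real \<Rightarrow> real^3) \<Rightarrow> bool" where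
  "unstable v D X N \<longleftrightarrow> \<not> stable v D X N"

definition e3 :: "real^3" where
  "e3 = vector [0, 0, 1]"

definition alpha1 :: "real \<Rightarrow> real" where
  "alpha1 s = - s + 2 * arctan s"

definition alpha3 :: "real \<Rightarrow> real" where
  "alpha3 s = ln (1 + s\<^sup>2)"

definition Psi :: "real \<times> real \<Rightarrow> real^3" where
  "Psi = (\<lambda>(s, t). vector [alpha1 s, t, alpha3 s])"

definition Psi_normal :: "real \<times> real \<Rightarrow> real^3" where
  "Psi_normal = (\<lambda>(s, t). vector [- deriv alpha3 s, 0, deriv alpha1 s])"

definition Sigma_dom :: "real \<Rightarrow> real \<Rightarrow> (real \<times> real) set" where
  "Sigma_dom s0 L = {- s0..s0} \<times> {0..L}"

definition varphi :: "real \<Rightarrow> real" where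
  "varphi s = - (s ^ 3 / 3) - 9 * s + (9 + 6 * s\<^sup>2 - 3 * s ^ 4) * arctan s"

definition L0 :: "real \<Rightarrow> real" where
  "L0 s0 = 8 * pi * s0 powr (5 / 2) *
     (15 * (s0 ^ 3 / 3 + 9 * s0 - (9 + 6 * s0\<^sup>2 - 3 * s0 ^ 4) * arctan s0)) powr (- 1 / 2)"

end

theory Submission
  imports Defs
begin

text \<open>
  In the parameters \<open>(s, t)\<close> the surface is as simple as it can be. The profile curve has unit
  speed, so the first fundamental form is the identity matrix; the weight \<open>e\<^sup>\<phi>\<close> is
  \<open>1 + s\<^sup>2\<close>; the principal curvatures are \<open>2 / (1 + s\<^sup>2)\<close> and \<open>0\<close>. The soliton equation is
  then the identity \<open>2 / (1 + s\<^sup>2) = (1 - s\<^sup>2) / (1 + s\<^sup>2) + 1\<close>, and the second variation of a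
  product \<open>g(s) w(t)\<close> splits into one-dimensional integrals (\<open>Q_phi_separable\<close>).

  Instability is witnessed by
  \<open>u(s, t) = (s0\<^sup>2 - s\<^sup>2) (1 + s\<^sup>2)\<^bsup>-1/2\<^esup> sin (2 \<pi> t / L)\<close>. The sine runs through a whole period,
  so it vanishes at both ends of \<open>[0, L]\<close> and has integral zero there; hence \<open>u\<close> preserves the
  volume whatever its factor in \<open>s\<close> is, and that factor only has to vanish at \<open>s = - s0\<close> and
  \<open>s = s0\<close>. The factor
  \<open>(1 + s\<^sup>2)\<^bsup>-1/2\<^esup>\<close> cancels the weight in the term with \<open>u\<^sub>t\<close>, leaving the integral of a polynomial
  there, and a rational function with an elementary primitive in the other terms. The outcome
  (\<open>Q_phi_unstable_mode\<close>) is
  \<open>Q(u) = L/2 * (varphi s0 + (2 \<pi> / L)\<^sup>2 * 16/15 * s0^5)\<close>.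
  The first summand does not involve \<open>L\<close> and the second one decreases in \<open>L\<close>, so that
  \<open>Q(u) < 0\<close> for large \<open>L\<close> as soon as \<open>varphi s0 < 0\<close>; the threshold \<open>L0 s0\<close> is the length at
  which the bracket is zero.

  The sign of \<open>varphi\<close> is found after division by \<open>3 (3 - s\<^sup>2) (1 + s\<^sup>2)\<close>, the factor of
  \<open>arctan s\<close>. The quotient is \<open>arctan\<close> minus a rational function, so its derivative is
  rational; its sign shows that the quotient starts from \<open>0\<close>, first increases and then decreases
  up to \<open>s = sqrt 3\<close>, beyond which \<open>varphi\<close> is negative anyway. Hence there is one positive zero,
  and evaluating \<open>varphi\<close> at two points locates it (\<open>varphi_bracket\<close>).
\<close>

section \<open>Smooth functions\<close>

lemma Ck_on_cong:
  assumes "open U" "\<And>x. x \<in> U \<Longrightarrow> f x = g x" "Ck_on k U f"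
  shows "Ck_on k U g"
  using assms(2,3)
proof (induction k arbitrary: f g)
  case 0
  then show ?case by (simp cong: continuous_on_cong)
next
  case (Suc k)
  have d: "(g has_derivative frechet_derivative f (at x)) (at x)" if "x \<in> U" for x
    using Suc.prems that assms(1)
    by (auto intro: has_derivative_transform_within_open[OF _ assms(1) that]
        simp: frechet_derivative_works)
  have "Ck_on k U (\<lambda>x. frechet_derivative g (at x) h)" for h
  proof (rule Suc.IH)
    show "Ck_on k U (\<lambda>x. frechet_derivative f (at x) h)"
      using Suc.prems by simp
    show "frechet_derivative f (at x) h = frechet_derivative g (at x) h" if "x \<in> U" for x
      using frechet_derivative_at[OF d[OF that]] by simp
  qed
  then show ?case
    using d by (auto simp: differentiable_def)
qed

text \<open>
  The \<open>Ck_on\<close> recursion is phrased with the chosen derivative \<open>frechet_derivative\<close>. This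
  introduction rule admits any formula for the derivative instead, and the closure
  properties below rest on it.
\<close>
lemma Ck_on_SucI:
  assumes "open U" "\<And>x. x \<in> U \<Longrightarrow> (f has_derivative f' x) (at x)"
    and "\<And>h. Ck_on k U (\<lambda>x. f' x h)"
  shows "Ck_on (Suc k) U f"
proof -
  have "f' x h = frechet_derivative f (at x) h" if "x \<in> U" for x h
    using frechet_derivative_at[OF assms(2)[OF that]] by simp
  then have "Ck_on k U (\<lambda>x. frechet_derivative f (at x) h)" for h
    by (intro Ck_on_cong[OF assms(1) _ assms(3)[of h]])
  then show ?thesis
    using assms(2) by (auto simp: differentiable_def)
qed

lemma Ck_on_Suc_lower: "Ck_on (Suc k) U f \<Longrightarrow> Ck_on k U f"
proof (induction k arbitrary: f)
  case 0
  then show ?case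
    by (auto intro!: continuous_at_imp_continuous_on differentiable_imp_continuous_within)
qed auto

lemma Ck_on_SucD:
  assumes "Ck_on (Suc k) U f"
  shows "\<And>x. x \<in> U \<Longrightarrow> (f has_derivative frechet_derivative f (at x)) (at x)"
    and "Ck_on k U (\<lambda>x. frechet_derivative f (at x) h)"
  using assms by (auto simp: frechet_derivative_works)

lemma Ck_on_const: "open U \<Longrightarrow> Ck_on k U (\<lambda>x. c)"
  by (induction k arbitrary: c) auto

lemma Ck_on_bounded_linear:
  assumes "open U" "bounded_linear l"
  shows "Ck_on k U l"
proof (cases k)
  case 0
  then show ?thesis
    using assms by (simp add: linear_continuous_on)
next
  case (Suc n)
  show ?thesis
    unfolding Suc
    by (rule Ck_on_SucI[OF assms(1)])
       (auto intro: bounded_linear_imp_has_derivative assms Ck_on_const)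
qed

lemma Ck_on_bounded_linear_compose:
  assumes "open U" "bounded_linear l" "Ck_on k U f"
  shows "Ck_on k U (\<lambda>x. l (f x))"
  using assms(3)
proof (induction k arbitrary: f)
  case 0
  then show ?case
    using assms(2) by (simp add: bounded_linear.continuous_on)
next
  case (Suc k)
  show ?case
    by (rule Ck_on_SucI[OF assms(1)])
       (auto intro!: bounded_linear.has_derivative[OF assms(2)] Ck_on_SucD[OF Suc.prems] Suc.IH)
qed

lemma Ck_on_add:
  assumes "open U" "Ck_on k U f" "Ck_on k U g"
  shows "Ck_on k U (\<lambda>x. f x + g x)"
  using assms(2,3)
proof (induction k arbitrary: f g)
  case 0
  then show ?case by (simp add: continuous_on_add)
next
  case (Suc k)
  show ?case
    by (rule Ck_on_SucI[OF assms(1)])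
       (auto intro!: has_derivative_add Ck_on_SucD[OF Suc.prems(1)]
          Ck_on_SucD[OF Suc.prems(2)] Suc.IH)
qed

text \<open>
  The product rule turns order \<open>k + 1\<close> of a product into order \<open>k\<close> of products of a factor with a
  derivative of the other one; the undifferentiated factor has order \<open>k\<close> by \<open>Ck_on_Suc_lower\<close>.
\<close>
lemma Ck_on_mult:
  fixes f g :: "'a::real_normed_vector \<Rightarrow> 'b::real_normed_algebra"
  assumes "open U" "Ck_on k U f" "Ck_on k U g"
  shows "Ck_on k U (\<lambda>x. f x * g x)"
  using assms(2,3)
proof (induction k arbitrary: f g)
  case 0
  then show ?case by (simp add: continuous_on_mult)
next
  case (Suc k)
  show ?case
    by (rule Ck_on_SucI[OF assms(1)], rule has_derivative_mult)
       (auto intro!: Ck_on_SucD[OF Suc.prems(1)] Ck_on_SucD[OF Suc.prems(2)]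
          Ck_on_add[OF assms(1)] Suc.IH Suc.prems[THEN Ck_on_Suc_lower])
qed

lemma smooth_on_const: "open U \<Longrightarrow> smooth_on U (\<lambda>x. c)"
  by (simp add: smooth_on_def Ck_on_const)

lemma smooth_on_bounded_linear:
  "open U \<Longrightarrow> bounded_linear l \<Longrightarrow> smooth_on U l"
  by (simp add: smooth_on_def Ck_on_bounded_linear)

lemma smooth_on_bounded_linear_compose:
  "open U \<Longrightarrow> bounded_linear l \<Longrightarrow> smooth_on U f \<Longrightarrow> smooth_on U (\<lambda>x. l (f x))"
  by (simp add: smooth_on_def Ck_on_bounded_linear_compose)

lemma smooth_on_add:
  "open U \<Longrightarrow> smooth_on U f \<Longrightarrow> smooth_on U g \<Longrightarrow> smooth_on U (\<lambda>x. f x + g x)"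
  by (simp add: smooth_on_def Ck_on_add)

lemma smooth_on_mult:
  fixes f g :: "'a::real_normed_vector \<Rightarrow> 'b::real_normed_algebra"
  shows "open U \<Longrightarrow> smooth_on U f \<Longrightarrow> smooth_on U g \<Longrightarrow> smooth_on U (\<lambda>x. f x * g x)"
  by (simp add: smooth_on_def Ck_on_mult)

text \<open>
  A bootstrap for composing with elementary functions. If the derivatives of all members of a
  family \<open>g i\<close> are as regular along \<open>f\<close> as the members themselves, then every composition
  \<open>g i (f x)\<close> gains one order in each step, and so is smooth. A function whose derivative is a
  polynomial in the function itself, or is already known to be smooth along \<open>f\<close>, forms such a family
  on its own; the sine needs the family of its translates.
\<close>
lemma smooth_on_compose_family:
  fixes f :: "'a::real_normed_vector \<Rightarrow> real" and g :: "'i \<Rightarrow> real \<Rightarrow> real"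
  assumes U: "open U" and f: "smooth_on U f"
    and der: "\<And>i x. x \<in> U \<Longrightarrow> (g i has_real_derivative g' i (f x)) (at (f x))"
    and step: "\<And>i k. (\<And>j. Ck_on k U (\<lambda>x. g j (f x))) \<Longrightarrow> Ck_on k U (\<lambda>x. g' i (f x))"
  shows "smooth_on U (\<lambda>x. g i (f x))"
proof -
  have "Ck_on k U (\<lambda>x. g i (f x))" for k
  proof (induction k arbitrary: i)
    case 0
    have "isCont (g i) (f x)" if "x \<in> U" for x
      using der[OF that] by (rule DERIV_isCont)
    then show ?case
      using f[unfolded smooth_on_def, rule_format, of 0] U
      by (auto simp: continuous_on_eq_continuous_at intro: isCont_o2)
  next
    case (Suc k)
    note f' = Ck_on_SucD[OF f[unfolded smooth_on_def, rule_format]]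
    have d: "((\<lambda>x. g i (f x)) has_derivative
        (\<lambda>h. g' i (f x) * frechet_derivative f (at x) h)) (at x)" if "x \<in> U" for x
      using has_derivative_compose[OF f'(1)[OF that] der[OF that, unfolded has_field_derivative_def]]
      by simp
    show ?case
      by (rule Ck_on_SucI[OF U d]) (auto intro!: Ck_on_mult[OF U] f' step Suc.IH)
  qed
  then show ?thesis by (simp add: smooth_on_def)
qed

lemmas smooth_on_compose = smooth_on_compose_family[where g = "\<lambda>_::unit. g" and g' = "\<lambda>_. g'" for g g']

text \<open>
  The reciprocal solves \<open>y' = - y\<^sup>2\<close>, an instance of the bootstrap.
\<close>
lemma smooth_on_inverse:
  fixes f :: "'a::real_normed_vector \<Rightarrow> real"
  assumes "open U" "smooth_on U f" "\<And>x. x \<in> U \<Longrightarrow> f x \<noteq> 0"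
  shows "smooth_on U (\<lambda>x. inverse (f x))"
proof (rule smooth_on_compose[OF assms(1,2), where g = inverse and g' = "\<lambda>y. (-1) * (inverse y * inverse y)"])
  show "(inverse has_real_derivative (-1) * (inverse (f x) * inverse (f x))) (at (f x))"
    if "x \<in> U" for x
    using DERIV_inverse[OF assms(3)[OF that]] by (simp add: power2_eq_square)
qed (intro Ck_on_mult Ck_on_const assms(1))

lemma smooth_on_ln:
  fixes f :: "'a::real_normed_vector \<Rightarrow> real"
  assumes "open U" "smooth_on U f" "\<And>x. x \<in> U \<Longrightarrow> f x > 0"
  shows "smooth_on U (\<lambda>x. ln (f x))"
proof (rule smooth_on_compose[OF assms(1,2), where g = ln and g' = inverse])
  show "(ln has_real_derivative inverse (f x)) (at (f x))" if "x \<in> U" for x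
    using assms(3)[OF that] by (auto intro!: derivative_eq_intros simp: inverse_eq_divide)
  show "Ck_on k U (\<lambda>x. inverse (f x))" for k
    using smooth_on_inverse[OF assms(1,2)] assms(3) by (force simp: smooth_on_def)
qed

lemma smooth_on_arctan:
  fixes f :: "'a::real_normed_vector \<Rightarrow> real"
  assumes "open U" "smooth_on U f"
  shows "smooth_on U (\<lambda>x. arctan (f x))"
proof (rule smooth_on_compose[OF assms, where g = arctan and g' = "\<lambda>y. inverse (1 + y * y)"])
  show "(arctan has_real_derivative inverse (1 + f x * f x)) (at (f x))" for x
    using DERIV_arctan[of "f x"] by (simp add: power2_eq_square)
  have "1 + f x * f x \<noteq> 0" for x
    using zero_le_square[of "f x"] by linarith
  then have "smooth_on U (\<lambda>x. inverse (1 + f x * f x))"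
    using assms by (intro smooth_on_inverse smooth_on_add smooth_on_mult smooth_on_const)
  then show "Ck_on k U (\<lambda>x. inverse (1 + f x * f x))" for k
    by (simp add: smooth_on_def)
qed

text \<open>
  The function \<open>1 / sqrt\<close> solves \<open>y' = - y\<^sup>3 / 2\<close>, an instance of the bootstrap.
\<close>
lemma smooth_on_inverse_sqrt:
  fixes f :: "'a::real_normed_vector \<Rightarrow> real"
  assumes "open U" "smooth_on U f" "\<And>x. x \<in> U \<Longrightarrow> f x > 0"
  shows "smooth_on U (\<lambda>x. inverse (sqrt (f x)))"
proof (rule smooth_on_compose[OF assms(1,2), where g = "\<lambda>y. inverse (sqrt y)"
      and g' = "\<lambda>y. (-1/2) * (inverse (sqrt y) * (inverse (sqrt y) * inverse (sqrt y)))"])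
  show "((\<lambda>y. inverse (sqrt y)) has_real_derivative
      (-1/2) * (inverse (sqrt (f x)) * (inverse (sqrt (f x)) * inverse (sqrt (f x))))) (at (f x))"
    if "x \<in> U" for x
    using assms(3)[OF that] by (auto intro!: derivative_eq_intros simp: field_simps)
qed (intro Ck_on_mult Ck_on_const assms(1))

text \<open>
  Differentiating \<open>sin\<close> shifts its argument by a quarter period, so the translates of \<open>sin\<close> form
  a family closed under differentiation.
\<close>
lemma smooth_on_sin:
  fixes f :: "'a::real_normed_vector \<Rightarrow> real"
  assumes "open U" "smooth_on U f"
  shows "smooth_on U (\<lambda>x. sin (f x))"
proof -
  have der: "((\<lambda>y. sin (y + c)) has_real_derivative sin (f x + (c + pi / 2))) (at (f x))" for c x
    by (auto intro!: derivative_eq_intros simp: sin_add cos_add)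
  show ?thesis
    using smooth_on_compose_family[OF assms, where g = "\<lambda>c y. sin (y + c)"
      and g' = "\<lambda>c y. sin (y + (c + pi / 2))" and i = 0] der by simp
qed

section \<open>Geometry of the cylindrical soliton\<close>

text \<open>
  Reduces the calculus of triples to that of sums of real functions times fixed vectors.
\<close>
lemma vector3_eq: "(vector [a, b, c] :: real^3) = a *\<^sub>R vector [1, 0, 0] + b *\<^sub>R vector [0, 1, 0] + c *\<^sub>R vector [0, 0, 1]"
  by (simp add: vec_eq_iff forall_3 vector_3)

lemma inner_vector3: "(vector [a, b, c] :: real^3) \<bullet> vector [a', b', c'] = a * a' + b * b' + c * c'"
  by (simp add: inner_vec_def sum_3 vector_3)

lemma has_derivative_vector3:
  assumes "(f has_derivative f') F" "(g has_derivative g') F" "(k has_derivative k') F"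
  shows "((\<lambda>p. vector [f p, g p, k p] :: real^3) has_derivative (\<lambda>h. vector [f' h, g' h, k' h])) F"
  unfolding vector3_eq[of "f _"] vector3_eq[of "f' _"]
  using assms by (intro has_derivative_add has_derivative_scaleR_left)

lemma smooth_on_vector3:
  assumes "open U" "smooth_on U f" "smooth_on U g" "smooth_on U k"
  shows "smooth_on U (\<lambda>p. vector [f p, g p, k p] :: real^3)"
  unfolding vector3_eq[of "f _"]
  using assms
  by (intro smooth_on_add smooth_on_bounded_linear_compose[OF assms(1) bounded_linear_scaleR_left])

lemma matrix_inv_mat_1: "matrix_inv (mat 1 :: real^'n^'n) = mat 1"
  by (simp add: matrix_inv_def)

lemma pderivative_eq:
  assumes "(f has_derivative f') (at p)"
  shows "pderivative 1 f p = f' (1, 0)" "pderivative 2 f p = f' (0, 1)"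
  using frechet_derivative_at[OF assms] by (simp_all add: pderivative_def coord_vec_def)

lemma one_plus_square_pos: "1 + s\<^sup>2 > (0::real)"
  by (simp add: add_pos_nonneg)

lemma one_plus_square_nz: "1 + s\<^sup>2 \<noteq> (0::real)"
  using one_plus_square_pos[of s] by simp

lemma alpha1_deriv: "(alpha1 has_real_derivative (1 - s\<^sup>2) / (1 + s\<^sup>2)) (at s)"
  unfolding alpha1_def using one_plus_square_nz[of s]
  by (auto intro!: derivative_eq_intros simp: field_simps power2_eq_square)

lemma alpha3_deriv: "(alpha3 has_real_derivative 2 * s / (1 + s\<^sup>2)) (at s)"
  unfolding alpha3_def using one_plus_square_pos[of s]
  by (auto intro!: derivative_eq_intros)

lemma Psi_normal_eq:
  "Psi_normal = (\<lambda>p. vector [- (2 * fst p / (1 + (fst p)\<^sup>2)), 0, (1 - (fst p)\<^sup>2) / (1 + (fst p)\<^sup>2)])"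
  by (auto simp: Psi_normal_def DERIV_imp_deriv[OF alpha1_deriv] DERIV_imp_deriv[OF alpha3_deriv])

lemma Psi_eq: "Psi = (\<lambda>p. vector [alpha1 (fst p), snd p, alpha3 (fst p)])"
  by (auto simp: Psi_def)

lemma has_derivative_of_fst:
  assumes "(f has_real_derivative d) (at (fst p))"
  shows "((\<lambda>q. f (fst q)) has_derivative (\<lambda>h. d * fst h)) (at p)"
  using has_derivative_compose[OF has_derivative_fst[OF has_derivative_ident],
      of f "(*) d" p UNIV] assms
  by (simp add: has_field_derivative_def)

lemma has_derivative_of_snd:
  assumes "(f has_real_derivative d) (at (snd p))"
  shows "((\<lambda>q. f (snd q)) has_derivative (\<lambda>h. d * snd h)) (at p)"
  using has_derivative_compose[OF has_derivative_snd[OF has_derivative_ident],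
      of f "(*) d" p UNIV] assms
  by (simp add: has_field_derivative_def)

lemma Psi_has_derivative:
  "(Psi has_derivative (\<lambda>h. vector [(1 - (fst p)\<^sup>2) / (1 + (fst p)\<^sup>2) * fst h, snd h,
      2 * fst p / (1 + (fst p)\<^sup>2) * fst h])) (at p)"
  unfolding Psi_eq
  by (intro has_derivative_vector3 has_derivative_of_fst alpha1_deriv alpha3_deriv
      has_derivative_snd has_derivative_ident)

lemma Psi_normal_has_derivative:
  "(Psi_normal has_derivative (\<lambda>h. vector [- (2 * (1 - (fst p)\<^sup>2) / (1 + (fst p)\<^sup>2)\<^sup>2) * fst h, 0,
      - (4 * fst p / (1 + (fst p)\<^sup>2)\<^sup>2) * fst h])) (at p)"
proof -
  have 1: "((\<lambda>s. - (2 * s / (1 + s\<^sup>2))) has_real_derivative - (2 * (1 - s\<^sup>2) / (1 + s\<^sup>2)\<^sup>2)) (at s)" for s :: real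
    using one_plus_square_nz[of s]
    by (auto intro!: derivative_eq_intros simp: field_simps power2_eq_square)
  have 2: "((\<lambda>s. (1 - s\<^sup>2) / (1 + s\<^sup>2)) has_real_derivative - (4 * s / (1 + s\<^sup>2)\<^sup>2)) (at s)" for s :: real
    using one_plus_square_nz[of s]
    by (auto intro!: derivative_eq_intros simp: field_simps power2_eq_square)
  show ?thesis
    unfolding Psi_normal_eq
    by (intro has_derivative_vector3 has_derivative_of_fst[OF 1] has_derivative_of_fst[OF 2]
        has_derivative_const)
qed

lemma pderivative_Psi:
  "pderivative 1 Psi (s, t) = vector [(1 - s\<^sup>2) / (1 + s\<^sup>2), 0, 2 * s / (1 + s\<^sup>2)]"
  "pderivative 2 Psi (s, t) = vector [0, 1, 0]"
  using pderivative_eq[OF Psi_has_derivative[of "(s, t)"]] by simp_all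

lemma pderivative_Psi_normal:
  "pderivative 1 Psi_normal (s, t) = vector [- (2 * (1 - s\<^sup>2) / (1 + s\<^sup>2)\<^sup>2), 0, - (4 * s / (1 + s\<^sup>2)\<^sup>2)]"
  "pderivative 2 Psi_normal (s, t) = 0"
  using pderivative_eq[OF Psi_normal_has_derivative[of "(s, t)"]] by (simp_all add: vec_eq_iff forall_3 vector_3)

text \<open>
  Unit speed of the profile curve: \<open>(1 - s\<^sup>2, 2 s) / (1 + s\<^sup>2)\<close> is the rational
  parametrization of the circle.
\<close>
lemma profile_unit_speed: "((1 - s\<^sup>2) / (1 + s\<^sup>2))\<^sup>2 + (2 * s / (1 + s\<^sup>2))\<^sup>2 = (1::real)"
proof -
  have "((1 - s\<^sup>2) / (1 + s\<^sup>2))\<^sup>2 + (2 * s / (1 + s\<^sup>2))\<^sup>2 = ((1 - s\<^sup>2)\<^sup>2 + (2 * s)\<^sup>2) / (1 + s\<^sup>2)\<^sup>2"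
    by (simp add: power_divide add_divide_distrib)
  also have "(1 - s\<^sup>2)\<^sup>2 + (2 * s)\<^sup>2 = (1 + s\<^sup>2)\<^sup>2"
    by algebra
  finally show ?thesis
    using one_plus_square_nz[of s] by simp
qed

lemma first_ff_Psi: "first_ff Psi p = mat 1"
proof (cases p)
  case (Pair s t)
  show ?thesis
    unfolding Pair using profile_unit_speed[of s]
    by (simp add: vec_eq_iff forall_2 first_ff_def mat_def pderivative_Psi inner_vector3 power2_eq_square)
qed

text \<open>
  Only the profile direction is curved, and its curvature \<open>2 / (1 + s\<^sup>2)\<close> is the rate at which
  the unit tangent above turns.
\<close>
lemma shape_op_Psi:
  "shape_op Psi Psi_normal (s, t) = (\<chi> i j. if i = 1 \<and> j = 1 then 2 / (1 + s\<^sup>2) else 0)"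
proof -
  define w where "w = 1 + s\<^sup>2"
  have w: "w \<noteq> 0"
    using one_plus_square_nz by (simp add: w_def)
  have "(1 - s\<^sup>2) / w * (2 * (1 - s\<^sup>2) / w\<^sup>2) + 2 * s / w * (4 * s / w\<^sup>2)
      = 2 * ((1 - s\<^sup>2)\<^sup>2 + (2 * s)\<^sup>2) / w ^ 3"
    using w by (simp add: field_simps power2_eq_square power3_eq_cube)
  also have "(1 - s\<^sup>2)\<^sup>2 + (2 * s)\<^sup>2 = w\<^sup>2"
    unfolding w_def by algebra
  also have "2 * w\<^sup>2 / w ^ 3 = 2 / w"
    using w by (simp add: power2_eq_square power3_eq_cube)
  finally have "(1 - s\<^sup>2) / w * (2 * (1 - s\<^sup>2) / w\<^sup>2) + 2 * s / w * (4 * s / w\<^sup>2) = 2 / w" .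
  then have "second_ff Psi Psi_normal (s, t) = (\<chi> i j. if i = 1 \<and> j = 1 then 2 / w else 0)"
    by (simp add: vec_eq_iff forall_2 second_ff_def pderivative_Psi pderivative_Psi_normal
        inner_vector3 flip: w_def)
  then show ?thesis
    unfolding w_def by (simp add: shape_op_def first_ff_Psi matrix_inv_mat_1)
qed

lemma mean_curv_Psi: "mean_curv Psi Psi_normal (s, t) = 2 / (1 + s\<^sup>2)"
  by (simp add: mean_curv_def trace_def sum_2 shape_op_Psi)

lemma norm_A_sq_Psi: "norm_A_sq Psi Psi_normal (s, t) = 4 / (1 + s\<^sup>2)\<^sup>2"
  by (simp add: norm_A_sq_def trace_def sum_2 shape_op_Psi matrix_matrix_mult_def power2_eq_square)

lemma Sigma_dom_cbox: "Sigma_dom s0 L = cbox (- s0, 0) (s0, L)"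
  by (auto simp: Sigma_dom_def cbox_Pair_eq)

lemma closure_interior_Sigma_dom:
  "0 < s0 \<Longrightarrow> 0 < L \<Longrightarrow> closure (interior (Sigma_dom s0 L)) = Sigma_dom s0 L"
  by (simp add: Sigma_dom_def interior_Times closure_Times)

lemma smooth_on_fst: "open U \<Longrightarrow> smooth_on U fst"
  and smooth_on_snd: "open U \<Longrightarrow> smooth_on U snd"
  by (simp_all add: smooth_on_bounded_linear bounded_linear_fst bounded_linear_snd)

lemma smooth_on_one_plus_fst_sq: "smooth_on UNIV (\<lambda>p::real \<times> real. 1 + (fst p)\<^sup>2)"
  unfolding power2_eq_square
  by (intro smooth_on_add smooth_on_mult smooth_on_const smooth_on_fst open_UNIV)

lemma smooth_on_Psi: "smooth_on UNIV Psi"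
proof -
  have "smooth_on UNIV (\<lambda>p::real \<times> real. (-1) * fst p + 2 * arctan (fst p))"
    by (intro smooth_on_add smooth_on_mult smooth_on_const smooth_on_arctan smooth_on_fst open_UNIV)
  moreover have "smooth_on UNIV (\<lambda>p::real \<times> real. ln (1 + (fst p)\<^sup>2))"
    by (intro smooth_on_ln smooth_on_one_plus_fst_sq open_UNIV one_plus_square_pos)
  ultimately show ?thesis
    unfolding Psi_eq alpha1_def alpha3_def
    by (intro smooth_on_vector3 smooth_on_snd open_UNIV) simp_all
qed

lemma smooth_on_Psi_normal: "smooth_on UNIV Psi_normal"
proof -
  have "smooth_on UNIV (\<lambda>p::real \<times> real. vector [(-2) * fst p * inverse (1 + (fst p)\<^sup>2), 0,
      (1 + (-1) * (fst p * fst p)) * inverse (1 + (fst p)\<^sup>2)] :: real^3)"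
    by (intro smooth_on_vector3 smooth_on_add smooth_on_mult smooth_on_const smooth_on_inverse
        smooth_on_fst smooth_on_one_plus_fst_sq open_UNIV one_plus_square_nz)
  then show ?thesis
    by (simp add: Psi_normal_eq divide_inverse power2_eq_square)
qed

lemma smooth_nearI: "smooth_on UNIV f \<Longrightarrow> smooth_near D f"
  by (auto simp: smooth_near_def)

text \<open>
  The differential is injective because the profile tangent is a unit vector orthogonal to the
  ruling direction.
\<close>
lemma inj_dPsi: "inj (frechet_derivative Psi (at p))"
proof (rule injI)
  fix h k assume "frechet_derivative Psi (at p) h = frechet_derivative Psi (at p) k"
  then have eqs: "(1 - (fst p)\<^sup>2) / (1 + (fst p)\<^sup>2) * fst h = (1 - (fst p)\<^sup>2) / (1 + (fst p)\<^sup>2) * fst k"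
    "2 * fst p / (1 + (fst p)\<^sup>2) * fst h = 2 * fst p / (1 + (fst p)\<^sup>2) * fst k" "snd h = snd k"
    by (simp_all add: vec_eq_iff forall_3 vector_3 flip: frechet_derivative_at[OF Psi_has_derivative])
  have "fst h = fst k"
    using eqs(1,2) profile_unit_speed[of "fst p"] by algebra
  with eqs(3) show "h = k"
    by (simp add: prod_eq_iff)
qed

lemma translating_soliton_Sigma:
  assumes "0 < s0" "0 < L"
  shows "translating_soliton 1 e3 (Sigma_dom s0 L) Psi Psi_normal"
proof -
  have "Psi_normal p \<bullet> pderivative i Psi p = 0" for p i
    using exhaust_2[of i]
    by (cases p) (auto simp: Psi_normal_eq pderivative_Psi inner_vector3)
  moreover have "norm (Psi_normal p) = 1" for p
    using profile_unit_speed[of "fst p"]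
    by (simp add: norm_eq_1 Psi_normal_eq inner_vector3 power2_eq_square)
  moreover have "mean_curv Psi Psi_normal p = Psi_normal p \<bullet> e3 + 1" for p
    using one_plus_square_nz[of "fst p"] fun_cong[OF Psi_normal_eq, of p]
    by (cases p) (simp add: mean_curv_Psi e3_def inner_vector3 field_simps)
  moreover have "compact (Sigma_dom s0 L)"
    by (simp add: Sigma_dom_cbox)
  ultimately show ?thesis
    using closure_interior_Sigma_dom[OF assms]
    by (simp add: translating_soliton_def oriented_immersed_surface_def inj_dPsi
        smooth_nearI smooth_on_Psi smooth_on_Psi_normal)
qed

section \<open>The second variation of product functions\<close>

lemma integral_separable:
  fixes f k :: "real \<Rightarrow> real"
  assumes "continuous_on {a..b} f" "continuous_on {c..d} k"
  shows "continuous_on (cbox (a, c) (b, d)) (\<lambda>(s, t). f s * k t)"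
    and "integral (cbox (a, c) (b, d)) (\<lambda>(s, t). f s * k t) = integral {a..b} f * integral {c..d} k"
proof -
  have f: "continuous_on (cbox (a, c) (b, d)) (\<lambda>p. f (fst p))"
    by (rule continuous_on_compose2[OF assms(1)]) (auto simp: cbox_Pair_eq intro!: continuous_intros)
  have k: "continuous_on (cbox (a, c) (b, d)) (\<lambda>p. k (snd p))"
    by (rule continuous_on_compose2[OF assms(2)]) (auto simp: cbox_Pair_eq intro!: continuous_intros)
  show c: "continuous_on (cbox (a, c) (b, d)) (\<lambda>(s, t). f s * k t)"
    using continuous_on_mult[OF f k] by (simp add: case_prod_unfold)
  show "integral (cbox (a, c) (b, d)) (\<lambda>(s, t). f s * k t) = integral {a..b} f * integral {c..d} k"
    using integral_prod_continuous[OF c] by simp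
qed

lemma weighted_integral_Psi:
  "weighted_integral e3 D Psi f = integral D (\<lambda>(s, t). f (s, t) * (1 + s\<^sup>2))"
proof -
  have "exp (Psi p \<bullet> e3) = 1 + (fst p)\<^sup>2" for p
    by (simp add: Psi_eq e3_def inner_vector3 alpha3_def one_plus_square_pos)
  then show ?thesis
    by (simp add: weighted_integral_def first_ff_Psi case_prod_unfold)
qed

text \<open>
  Since the coordinate tangent vectors are orthonormal, the intrinsic gradient has the Euclidean
  norm of the coordinate gradient.
\<close>
lemma norm_surf_grad_Psi:
  "(norm (surf_grad Psi u p))\<^sup>2 = (pderivative 1 u p)\<^sup>2 + (pderivative 2 u p)\<^sup>2"
proof -
  define X where "X i = pderivative i Psi p" for i
  have "X i \<bullet> X j = (mat 1 :: real^2^2) $ i $ j" for i j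
    using first_ff_Psi[of p] by (simp add: vec_eq_iff first_ff_def X_def)
  then have "X 1 \<bullet> X 1 = 1" "X 1 \<bullet> X 2 = 0" "X 2 \<bullet> X 1 = 0" "X 2 \<bullet> X 2 = 1"
    by (simp_all add: mat_def)
  then show ?thesis
    unfolding power2_norm_eq_inner
    by (simp add: surf_grad_def first_ff_Psi matrix_inv_mat_1 sum_2
        inner_add_left inner_add_right power2_eq_square flip: X_def)
qed

text \<open>
  The curvature and the weight depend on \<open>s\<close> only, hence the integrand of the second variation of
  a product is a sum of two products of functions of one variable. The potential
  \<open>|A|\<^sup>2 = 4 / (1 + s\<^sup>2)\<^sup>2\<close> times the weight \<open>1 + s\<^sup>2\<close> gives the coefficient \<open>4 / (1 + s\<^sup>2)\<close>.
\<close>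
lemma Q_phi_separable:
  fixes g g' w w' :: "real \<Rightarrow> real"
  assumes g: "\<And>s. (g has_real_derivative g' s) (at s)" and g': "continuous_on {- s0..s0} g'"
    and w: "\<And>t. (w has_real_derivative w' t) (at t)" and w': "continuous_on {0..L} w'"
  shows "Q_phi e3 (Sigma_dom s0 L) Psi Psi_normal (\<lambda>(s, t). g s * w t) =
    integral {- s0..s0} (\<lambda>s. (1 + s\<^sup>2) * (g' s)\<^sup>2 - 4 / (1 + s\<^sup>2) * (g s)\<^sup>2) * integral {0..L} (\<lambda>t. (w t)\<^sup>2)
    + integral {- s0..s0} (\<lambda>s. (1 + s\<^sup>2) * (g s)\<^sup>2) * integral {0..L} (\<lambda>t. (w' t)\<^sup>2)"
proof -
  let ?P = "\<lambda>s. (1 + s\<^sup>2) * (g' s)\<^sup>2 - 4 / (1 + s\<^sup>2) * (g s)\<^sup>2" and ?R = "\<lambda>s. (1 + s\<^sup>2) * (g s)\<^sup>2"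
  have cont: "continuous_on S g" "continuous_on S w" for S
    using g w by (meson DERIV_isCont continuous_at_imp_continuous_on)+
  have "((\<lambda>p. g (fst p) * w (snd p)) has_derivative
      (\<lambda>h. g (fst p) * (w' (snd p) * snd h) + g' (fst p) * fst h * w (snd p))) (at p)" for p
    by (rule has_derivative_mult[OF has_derivative_of_fst[OF g] has_derivative_of_snd[OF w]])
  from pderivative_eq[OF this]
  have d: "pderivative 1 (\<lambda>(s, t). g s * w t) (s, t) = g' s * w t"
    "pderivative 2 (\<lambda>(s, t). g s * w t) (s, t) = g s * w' t" for s t
    by (simp_all add: case_prod_unfold)
  have alg: "((g' s * w t)\<^sup>2 + (g s * w' t)\<^sup>2 - 4 / (1 + s\<^sup>2)\<^sup>2 * (g s * w t)\<^sup>2) * (1 + s\<^sup>2)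
      = ?P s * (w t)\<^sup>2 + ?R s * (w' t)\<^sup>2" for s t
  proof -
    define v where "v = 1 + s\<^sup>2"
    have "v \<noteq> 0"
      using one_plus_square_nz by (simp add: v_def)
    then show ?thesis
      unfolding v_def[symmetric] by (simp add: field_simps power2_eq_square[of v] power_mult_distrib)
  qed
  have "Q_phi e3 (Sigma_dom s0 L) Psi Psi_normal (\<lambda>(s, t). g s * w t) =
      integral (cbox (- s0, 0) (s0, L)) (\<lambda>p. (case p of (s, t) \<Rightarrow> ?P s * (w t)\<^sup>2) + (case p of (s, t) \<Rightarrow> ?R s * (w' t)\<^sup>2))"
    unfolding Q_phi_def weighted_integral_Psi Sigma_dom_cbox
    by (rule arg_cong[where f = "integral _"])
       (simp only: fun_eq_iff split_paired_All prod.case norm_surf_grad_Psi d norm_A_sq_Psi alg simp_thms)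
  also have "\<dots> = integral {- s0..s0} ?P * integral {0..L} (\<lambda>t. (w t)\<^sup>2)
      + integral {- s0..s0} ?R * integral {0..L} (\<lambda>t. (w' t)\<^sup>2)"
  proof -
    have "continuous_on {- s0..s0} ?P" "continuous_on {- s0..s0} ?R"
      using g' one_plus_square_nz by (auto intro!: continuous_intros cont)
    moreover have "continuous_on {0..L} (\<lambda>t. (w t)\<^sup>2)" "continuous_on {0..L} (\<lambda>t. (w' t)\<^sup>2)"
      using w' by (auto intro!: continuous_intros cont)
    ultimately show ?thesis
      by (simp only: integral_add integrable_continuous integral_separable)
  qed
  finally show ?thesis .
qed

lemma has_integral_FTC:
  fixes F :: "real \<Rightarrow> real"
  assumes "a \<le> b" "\<And>x. (F has_real_derivative f x) (at x)"
  shows "(f has_integral (F b - F a)) {a..b}"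
  using assms
  by (intro fundamental_theorem_of_calculus)
     (auto intro: has_field_derivative_at_within simp flip: has_real_derivative_iff_has_vector_derivative)

section \<open>The destabilizing variation\<close>

text \<open>
  The parabola \<open>s0\<^sup>2 - s\<^sup>2\<close> makes the function vanish at both ends of the profile; dividing by the
  square root of the weight makes its weighted square the square of that polynomial.
\<close>
definition profile_bump :: "real \<Rightarrow> real \<Rightarrow> real" where
  "profile_bump s0 s = (s0\<^sup>2 - s\<^sup>2) * inverse (sqrt (1 + s\<^sup>2))"

text \<open>
  Everything that enters the second variation is quadratic, so the square root disappears.
\<close>
lemma profile_bump_sq: "(profile_bump s0 s)\<^sup>2 = (s0\<^sup>2 - s\<^sup>2)\<^sup>2 / (1 + s\<^sup>2)"
  using one_plus_square_pos[of s]
  by (simp add: profile_bump_def power_mult_distrib divide_inverse power_inverse)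

lemma profile_bump_deriv:
  "(profile_bump s0 has_real_derivative
     - s * (s\<^sup>2 + 2 + s0\<^sup>2) / (1 + s\<^sup>2) * inverse (sqrt (1 + s\<^sup>2))) (at s)"
proof -
  define r where "r = sqrt (1 + s\<^sup>2)"
  have r: "r > 0" "1 + s\<^sup>2 = r * r"
    using one_plus_square_pos[of s] by (simp_all add: r_def)
  have "(profile_bump s0 has_real_derivative
     (s0\<^sup>2 - s\<^sup>2) * (- (s / r) / (r * r)) + - (2 * s) * inverse (sqrt (1 + s\<^sup>2))) (at s)"
    unfolding profile_bump_def
  proof (rule DERIV_mult')
    show "((\<lambda>s. s0\<^sup>2 - s\<^sup>2) has_real_derivative - (2 * s)) (at s)"
      by (auto intro!: derivative_eq_intros)
    have "((\<lambda>s. sqrt (1 + s\<^sup>2)) has_real_derivative s / r) (at s)"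
      unfolding r_def using one_plus_square_pos[of s]
      by (auto intro!: derivative_eq_intros simp: field_simps)
    from DERIV_inverse'[OF this]
    show "((\<lambda>s. inverse (sqrt (1 + s\<^sup>2))) has_real_derivative - (s / r) / (r * r)) (at s)"
      using r by (simp add: divide_inverse mult_ac flip: r_def)
  qed
  moreover have "(s0\<^sup>2 - s\<^sup>2) * (- (s / r) / (r * r)) + - (2 * s) * inverse r
      = - s * (s\<^sup>2 + 2 + s0\<^sup>2) / (r * r) * inverse r"
  proof -
    have eq: "s\<^sup>2 + 2 + s0\<^sup>2 = 2 * (r * r) + (s0\<^sup>2 - s\<^sup>2)"
      by (simp flip: r(2))
    show ?thesis
      unfolding eq using r(1) by (simp add: field_simps)
  qed
  ultimately show ?thesis
    unfolding r_def[symmetric] unfolding r(2) by (simp only:)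
qed

lemma integral_profile_bump_mass:
  assumes "0 < s0"
  shows "integral {- s0..s0} (\<lambda>s. (1 + s\<^sup>2) * (profile_bump s0 s)\<^sup>2) = 16 / 15 * s0 ^ 5"
proof -
  have "((\<lambda>s. (s0\<^sup>2 - s\<^sup>2)\<^sup>2) has_integral
      (s0 ^ 4 * s0 - 2 / 3 * s0\<^sup>2 * s0 ^ 3 + s0 ^ 5 / 5)
      - (s0 ^ 4 * (- s0) - 2 / 3 * s0\<^sup>2 * (- s0) ^ 3 + (- s0) ^ 5 / 5)) {- s0..s0}"
    using assms
    by (intro has_integral_FTC) (auto intro!: derivative_eq_intros simp: field_simps eval_nat_numeral)
  then have "integral {- s0..s0} (\<lambda>s. (s0\<^sup>2 - s\<^sup>2)\<^sup>2) = 16 / 15 * s0 ^ 5"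
    by (rule integral_unique[THEN trans]) (simp add: field_simps eval_nat_numeral)
  then show ?thesis
    by (simp add: profile_bump_sq one_plus_square_nz)
qed

text \<open>
  This is where the function \<open>varphi\<close> comes from: it is the one-dimensional second variation of
  \<open>profile_bump\<close>. In terms of \<open>w = 1 + s\<^sup>2\<close> and \<open>b = 1 + s0\<^sup>2\<close> the integrand is
  \<open>w + (2 b - 5) + (b\<^sup>2 + 6 b) / w - 5 b\<^sup>2 / w\<^sup>2\<close>, and the coefficient of \<open>arctan s0\<close> in the
  integral is \<open>2 (b\<^sup>2 + 6 b) - 5 b\<^sup>2 = 12 b - 3 b\<^sup>2 = 9 + 6 s0\<^sup>2 - 3 s0\<^sup>4\<close>.
\<close>
lemma integral_profile_bump_form:
  assumes "0 < s0"
  shows "integral {- s0..s0} (\<lambda>s. (1 + s\<^sup>2) *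
      (- s * (s\<^sup>2 + 2 + s0\<^sup>2) / (1 + s\<^sup>2) * inverse (sqrt (1 + s\<^sup>2)))\<^sup>2
      - 4 / (1 + s\<^sup>2) * (profile_bump s0 s)\<^sup>2) = varphi s0"
proof -
  define b where "b = 1 + s0\<^sup>2"
  define F where "F s = s + s ^ 3 / 3 + (2 * b - 5) * s + (b\<^sup>2 + 6 * b) * arctan s
      - 5 * b\<^sup>2 / 2 * (s / (1 + s\<^sup>2) + arctan s)" for s
  have eq: "(1 + s\<^sup>2) * (- s * (s\<^sup>2 + 2 + s0\<^sup>2) / (1 + s\<^sup>2) * inverse (sqrt (1 + s\<^sup>2)))\<^sup>2
      - 4 / (1 + s\<^sup>2) * (profile_bump s0 s)\<^sup>2
      = (1 + s\<^sup>2) + (2 * b - 5) + (b\<^sup>2 + 6 * b) / (1 + s\<^sup>2) - 5 * b\<^sup>2 / (1 + s\<^sup>2)\<^sup>2" for s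
  proof -
    define w where "w = 1 + s\<^sup>2"
    have w: "w > 0" "s\<^sup>2 = w - 1" "s0\<^sup>2 = b - 1"
      using one_plus_square_pos by (auto simp: w_def b_def)
    have "w * (- s * (s\<^sup>2 + 2 + s0\<^sup>2) / w * inverse (sqrt w))\<^sup>2 - 4 / w * (profile_bump s0 s)\<^sup>2
        = (s\<^sup>2 * (s\<^sup>2 + 2 + s0\<^sup>2)\<^sup>2 - 4 * (s0\<^sup>2 - s\<^sup>2)\<^sup>2) / w\<^sup>2"
    proof -
      have "w * (- s * x / w * inverse (sqrt w))\<^sup>2 = s\<^sup>2 * x\<^sup>2 / w\<^sup>2" for x
        using w(1) by (simp add: power_mult_distrib power_divide power_inverse field_simps power2_eq_square[of w])
      moreover have "4 / w * (profile_bump s0 s)\<^sup>2 = 4 * (s0\<^sup>2 - s\<^sup>2)\<^sup>2 / w\<^sup>2"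
        unfolding profile_bump_sq w_def[symmetric] by (simp add: power2_eq_square[of w])
      ultimately show ?thesis
        by (simp only: diff_divide_distrib)
    qed
    also have "s\<^sup>2 * (s\<^sup>2 + 2 + s0\<^sup>2)\<^sup>2 - 4 * (s0\<^sup>2 - s\<^sup>2)\<^sup>2
        = w\<^sup>2 * w + (2 * b - 5) * w\<^sup>2 + (b\<^sup>2 + 6 * b) * w - 5 * b\<^sup>2"
      unfolding w(2,3) by algebra
    also have "\<dots> / w\<^sup>2 = w + (2 * b - 5) + (b\<^sup>2 + 6 * b) / w - 5 * b\<^sup>2 / w\<^sup>2"
      using w(1) by (simp add: add_divide_distrib diff_divide_distrib power2_eq_square)
    finally show ?thesis
      by (simp add: w_def)
  qed
  (* a primitive of the last term of the integrand, up to a constant factor *)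
  have half: "((\<lambda>s. s / (1 + s\<^sup>2) + arctan s) has_real_derivative 2 / (1 + s\<^sup>2)\<^sup>2) (at s)" for s :: real
  proof -
    define w where "w = 1 + s\<^sup>2"
    have w: "w \<noteq> 0" "s * (2 * s) = 2 * (w - 1)"
      using one_plus_square_nz by (auto simp: w_def power2_eq_square)
    have "((\<lambda>s. s / (1 + s\<^sup>2) + arctan s) has_real_derivative
        (w - s * (2 * s)) / (w * w) + inverse w) (at s)"
      using w(1) unfolding w_def by (auto intro!: derivative_eq_intros)
    moreover have "(w - s * (2 * s)) / (w * w) + inverse w = 2 / w\<^sup>2"
      unfolding w(2) using w(1) by (simp add: field_simps power2_eq_square)
    ultimately show ?thesis
      by (simp add: w_def)
  qed
  have F': "(F has_real_derivative
      (1 + s\<^sup>2) + (2 * b - 5) + (b\<^sup>2 + 6 * b) / (1 + s\<^sup>2) - 5 * b\<^sup>2 / (1 + s\<^sup>2)\<^sup>2) (at s)" for s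
  proof -
    have 1: "((\<lambda>s. s + s ^ 3 / 3 + (2 * b - 5) * s) has_real_derivative (1 + s\<^sup>2) + (2 * b - 5)) (at s)"
      by (auto intro!: derivative_eq_intros)
    have 2: "((\<lambda>s. (b\<^sup>2 + 6 * b) * arctan s) has_real_derivative (b\<^sup>2 + 6 * b) * inverse (1 + s\<^sup>2)) (at s)"
      by (rule DERIV_cmult[OF DERIV_arctan])
    have 3: "((\<lambda>s. 5 * b\<^sup>2 / 2 * (s / (1 + s\<^sup>2) + arctan s)) has_real_derivative
        5 * b\<^sup>2 / 2 * (2 / (1 + s\<^sup>2)\<^sup>2)) (at s)"
      by (rule DERIV_cmult[OF half])
    have 4: "5 * b\<^sup>2 / 2 * (2 / (1 + s\<^sup>2)\<^sup>2) = 5 * b\<^sup>2 / (1 + s\<^sup>2)\<^sup>2"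
      by simp
    show ?thesis
      unfolding F_def[abs_def] 4[symmetric] divide_inverse[of "b\<^sup>2 + 6 * b"]
      by (rule DERIV_diff[OF DERIV_add[OF 1 2] 3])
  qed
  have "((\<lambda>s. (1 + s\<^sup>2) + (2 * b - 5) + (b\<^sup>2 + 6 * b) / (1 + s\<^sup>2) - 5 * b\<^sup>2 / (1 + s\<^sup>2)\<^sup>2)
      has_integral (F s0 - F (- s0))) {- s0..s0}"
    using assms by (intro has_integral_FTC F') simp
  moreover have "F s0 - F (- s0) = varphi s0"
  proof -
    have "5 * b\<^sup>2 / 2 * (s0 / (1 + s0\<^sup>2) + arctan s0) = 5 * b * s0 / 2 + 5 * b\<^sup>2 / 2 * arctan s0"
    proof -
      have "b \<noteq> 0"
        using one_plus_square_nz by (simp add: b_def)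
      then show ?thesis
        unfolding b_def[symmetric] by (simp add: power2_eq_square[of b] field_simps)
    qed
    then have "F s0 = s0 + s0 ^ 3 / 3 + (2 * b - 5) * s0 + (b\<^sup>2 + 6 * b) * arctan s0
        - (5 * b * s0 / 2 + 5 * b\<^sup>2 / 2 * arctan s0)"
      unfolding F_def by (simp only:)
    moreover have "F (- s0) = - F s0"
    proof -
      have "- s0 / (1 + (- s0)\<^sup>2) + - arctan s0 = - (s0 / (1 + s0\<^sup>2) + arctan s0)"
        by simp
      moreover have "(- s0) ^ 3 = - (s0 ^ 3)"
        by simp
      ultimately show ?thesis
        unfolding F_def by (simp only: arctan_minus mult_minus_right)
    qed
    ultimately show ?thesis
      by (simp add: varphi_def b_def field_simps power2_eq_square power3_eq_cube power4_eq_xxxx)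
  qed
  ultimately show ?thesis
    unfolding eq by (simp add: integral_unique)
qed

lemma integral_sin_full_period:
  assumes "0 < L"
  shows "integral {0..L} (\<lambda>t. sin (2 * pi / L * t)) = 0"
    and "integral {0..L} (\<lambda>t. (sin (2 * pi / L * t))\<^sup>2) = L / 2"
    and "integral {0..L} (\<lambda>t. (2 * pi / L * cos (2 * pi / L * t))\<^sup>2) = (2 * pi / L)\<^sup>2 * (L / 2)"
proof -
  define c where "c = 2 * pi / L"
  have c: "c \<noteq> 0" "c * L = 2 * pi"
    using assms by (simp_all add: c_def)
  have trig: "sin (c * L) = 0" "cos (c * L) = 1"
    using c by simp_all
  have "((\<lambda>t. sin (c * t)) has_integral (- cos (c * L) / c) - (- cos (c * 0) / c)) {0..L}"
    using assms c by (intro has_integral_FTC) (auto intro!: derivative_eq_intros)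
  then show "integral {0..L} (\<lambda>t. sin (2 * pi / L * t)) = 0"
    using trig by (simp add: integral_unique flip: c_def)
  have "((\<lambda>t. (sin (c * t))\<^sup>2) has_integral
      (L / 2 - sin (c * L) * cos (c * L) / (2 * c)) - (0 / 2 - sin (c * 0) * cos (c * 0) / (2 * c))) {0..L}"
  proof (rule has_integral_FTC)
    fix t
    have "((\<lambda>t. t / 2 - sin (c * t) * cos (c * t) / (2 * c)) has_real_derivative
        1 / 2 - ((cos (c * t))\<^sup>2 - (sin (c * t))\<^sup>2) / 2) (at t)"
      using c by (auto intro!: derivative_eq_intros simp: field_simps power2_eq_square)
    moreover have "1 / 2 - ((cos (c * t))\<^sup>2 - (sin (c * t))\<^sup>2) / 2 = (sin (c * t))\<^sup>2"
      by (simp add: cos_squared_eq field_simps)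
    ultimately show "((\<lambda>t. t / 2 - sin (c * t) * cos (c * t) / (2 * c)) has_real_derivative
        (sin (c * t))\<^sup>2) (at t)"
      by simp
  qed (use assms in simp)
  then show "integral {0..L} (\<lambda>t. (sin (2 * pi / L * t))\<^sup>2) = L / 2"
    using trig by (simp add: integral_unique flip: c_def)
  have "((\<lambda>t. (c * cos (c * t))\<^sup>2) has_integral
      c\<^sup>2 * (L / 2 + sin (c * L) * cos (c * L) / (2 * c)) - c\<^sup>2 * (0 / 2 + sin (c * 0) * cos (c * 0) / (2 * c))) {0..L}"
  proof (rule has_integral_FTC)
    fix t
    have "((\<lambda>t. c\<^sup>2 * (t / 2 + sin (c * t) * cos (c * t) / (2 * c))) has_real_derivative
        c\<^sup>2 * (1 / 2 + ((cos (c * t))\<^sup>2 - (sin (c * t))\<^sup>2) / 2)) (at t)"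
      using c by (auto intro!: derivative_eq_intros simp: field_simps power2_eq_square)
    moreover have "c\<^sup>2 * (1 / 2 + ((cos (c * t))\<^sup>2 - (sin (c * t))\<^sup>2) / 2) = (c * cos (c * t))\<^sup>2"
      by (simp add: sin_squared_eq power_mult_distrib field_simps)
    ultimately show "((\<lambda>t. c\<^sup>2 * (t / 2 + sin (c * t) * cos (c * t) / (2 * c))) has_real_derivative
        (c * cos (c * t))\<^sup>2) (at t)"
      by simp
  qed (use assms in simp)
  then show "integral {0..L} (\<lambda>t. (2 * pi / L * cos (2 * pi / L * t))\<^sup>2) = (2 * pi / L)\<^sup>2 * (L / 2)"
    using trig by (simp add: integral_unique flip: c_def)
qed

definition unstable_mode :: "real \<Rightarrow> real \<Rightarrow> real \<times> real \<Rightarrow> real" where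
  "unstable_mode s0 L = (\<lambda>(s, t). profile_bump s0 s * sin (2 * pi / L * t))"

lemma smooth_unstable_mode: "smooth_on UNIV (unstable_mode s0 L)"
proof -
  have "smooth_on UNIV (\<lambda>p::real \<times> real. (s0\<^sup>2 + (-1) * (fst p * fst p)) *
      inverse (sqrt (1 + (fst p)\<^sup>2)) * sin (2 * pi / L * snd p))"
    by (intro smooth_on_add smooth_on_mult smooth_on_const smooth_on_inverse_sqrt smooth_on_sin
        smooth_on_fst smooth_on_snd smooth_on_one_plus_fst_sq open_UNIV one_plus_square_pos)
  then show ?thesis
    by (simp add: unstable_mode_def profile_bump_def case_prod_unfold power2_eq_square)
qed

lemma unstable_mode_frontier:
  assumes "0 < L" "p \<in> frontier (Sigma_dom s0 L)"
  shows "unstable_mode s0 L p = 0"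
proof -
  obtain s t where p: "p = (s, t)" by force
  have "s = - s0 \<or> s = s0 \<or> t = 0 \<or> t = L"
    using assms(2) by (auto simp: p Sigma_dom_def frontier_def closure_Times interior_Times)
  then show ?thesis
    using assms(1) by (auto simp: p unstable_mode_def profile_bump_def)
qed

text \<open>
  The integral over \<open>t\<close> is that of a sine over a full period. A half period would give a lower
  second variation, but not integral zero.
\<close>
lemma unstable_mode_mean_zero:
  assumes "0 < L"
  shows "weighted_integral e3 (Sigma_dom s0 L) Psi (unstable_mode s0 L) = 0"
proof -
  have "continuous_on {- s0..s0} (\<lambda>s. profile_bump s0 s * (1 + s\<^sup>2))"
    using one_plus_square_nz by (auto simp: profile_bump_def intro!: continuous_intros)
  moreover have "continuous_on {0..L} (\<lambda>t. sin (2 * pi / L * t))"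
    using assms by (auto intro!: continuous_intros)
  ultimately  have "integral (cbox (- s0, 0) (s0, L))
      (\<lambda>(s, t). profile_bump s0 s * (1 + s\<^sup>2) * sin (2 * pi / L * t)) = 0"
    using integral_separable(2) integral_sin_full_period(1)[OF assms] by simp
  then show ?thesis
    by (simp add: weighted_integral_Psi Sigma_dom_cbox unstable_mode_def mult_ac)
qed

lemma Q_phi_unstable_mode:
  assumes "0 < s0" "0 < L"
  shows "Q_phi e3 (Sigma_dom s0 L) Psi Psi_normal (unstable_mode s0 L) =
    L / 2 * (varphi s0 + (2 * pi / L)\<^sup>2 * (16 / 15 * s0 ^ 5))"
proof -
  have c: "continuous_on {- s0..s0} (\<lambda>s. - s * (s\<^sup>2 + 2 + s0\<^sup>2) / (1 + s\<^sup>2) * inverse (sqrt (1 + s\<^sup>2)))"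
    using one_plus_square_nz by (auto intro!: continuous_intros)
  have s: "((\<lambda>t. sin (2 * pi / L * t)) has_real_derivative 2 * pi / L * cos (2 * pi / L * t)) (at t)" for t
    using assms(2) by (auto intro!: derivative_eq_intros)
  have "Q_phi e3 (Sigma_dom s0 L) Psi Psi_normal (unstable_mode s0 L) =
    varphi s0 * (L / 2) + 16 / 15 * s0 ^ 5 * ((2 * pi / L)\<^sup>2 * (L / 2))"
    unfolding unstable_mode_def
    by (subst Q_phi_separable[OF profile_bump_deriv c s])
       (auto intro!: continuous_intros simp only: integral_profile_bump_form[OF assms(1)]
         integral_profile_bump_mass[OF assms(1)] integral_sin_full_period[OF assms(2)])
  then show ?thesis
    by (simp add: algebra_simps)
qed

section \<open>The sign of the threshold function\<close>

text \<open>
  Dividing \<open>varphi s\<close> by \<open>3 (3 - s\<^sup>2) (1 + s\<^sup>2)\<close> frees \<open>arctan s\<close> from its coefficient, so that a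
  single differentiation removes it. The pole at \<open>s\<^sup>2 = 3\<close> is harmless: from there on
  \<open>varphi s < 0\<close> because all its summands are nonpositive.
\<close>
definition soliton_quot :: "real \<Rightarrow> real" where
  "soliton_quot s = arctan s - (s ^ 3 + 27 * s) / (9 * ((3 - s\<^sup>2) * (1 + s\<^sup>2)))"

lemma varphi_eq_soliton_quot:
  assumes "s\<^sup>2 \<noteq> 3"
  shows "varphi s = 3 * (3 - s\<^sup>2) * (1 + s\<^sup>2) * soliton_quot s"
proof -
  define p q where "p = 3 - s\<^sup>2" and "q = 1 + s\<^sup>2"
  have nz: "p \<noteq> 0" "q \<noteq> 0"
    using assms by (auto simp: p_def q_def add_nonneg_eq_0_iff)
  have "3 * p * q * soliton_quot s = 3 * p * q * arctan s - (s ^ 3 + 27 * s) / 3"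
    using nz by (simp add: soliton_quot_def flip: p_def q_def) (simp add: field_simps)
  also have "\<dots> = varphi s"
    by (simp add: varphi_def p_def q_def field_simps power2_eq_square power4_eq_xxxx)
  finally show ?thesis by (simp add: p_def q_def)
qed

lemma soliton_quot_deriv:
  assumes "s\<^sup>2 \<noteq> 3"
  shows "(soliton_quot has_real_derivative
    8 * s\<^sup>2 * (s ^ 4 - 16 * s\<^sup>2 + 9) / (9 * ((3 - s\<^sup>2) * (1 + s\<^sup>2))\<^sup>2)) (at s)"
proof -
  define p q where "p = 3 - s\<^sup>2" and "q = 1 + s\<^sup>2"
  have nz: "p \<noteq> 0" "q \<noteq> 0"
    using assms by (auto simp: p_def q_def add_nonneg_eq_0_iff)
  have "(soliton_quot has_real_derivative
     (inverse q - ((3 * s\<^sup>2 + 27) * (9 * (p * q)) - (s ^ 3 + 27 * s) * (9 * ((- (2 * s)) * q + p * (2 * s))))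
        / (9 * (p * q))\<^sup>2)) (at s)"
    unfolding soliton_quot_def
    using nz unfolding p_def q_def
    by (auto intro!: derivative_eq_intros simp: power2_eq_square)
  moreover have "inverse q - ((3 * s\<^sup>2 + 27) * (9 * (p * q)) - (s ^ 3 + 27 * s) * (9 * ((- (2 * s)) * q + p * (2 * s))))
        / (9 * (p * q))\<^sup>2 =
     (9 * p\<^sup>2 * q - ((3 * s\<^sup>2 + 27) * (p * q) - (s ^ 3 + 27 * s) * ((- (2 * s)) * q + p * (2 * s)))) / (9 * (p * q)\<^sup>2)"
    using nz by (simp add: field_simps power2_eq_square)
  moreover have "9 * p\<^sup>2 * q - ((3 * s\<^sup>2 + 27) * (p * q) - (s ^ 3 + 27 * s) * ((- (2 * s)) * q + p * (2 * s)))
      = 8 * s\<^sup>2 * (s ^ 4 - 16 * s\<^sup>2 + 9)"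
    unfolding p_def q_def by algebra
  ultimately show ?thesis
    by (simp add: p_def q_def)
qed

text \<open>
  Brings arguments of \<open>arctan\<close> close to \<open>1\<close> down to arguments close to \<open>0\<close>, at which a single
  term of the series and its first correction are accurate enough.
\<close>
lemma arctan_shift_one:
  assumes "\<bar>x\<bar> < 1"
  shows "arctan ((1 + x) / (1 - x)) = pi / 4 + arctan x"
  using arctan_add[of 1 x] assms by (simp add: arctan_one)

text \<open>
  The values are about \<open>0.00024\<close> and \<open>-0.00022\<close>, and \<open>arctan\<close> enters with a coefficient of about
  \<open>12\<close>; an accuracy of \<open>10\<^bsup>-6\<^esup>\<close> for \<open>arctan\<close> is therefore ample.
\<close>
lemma varphi_bracket: "varphi 1.02125 > 0" "varphi 1.02135 < 0"
proof -
  (* 17 / 1617 = (x - 1) / (x + 1) for x = 1.02125, and similarly below *)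
  have 1: "arctan 1.02125 = pi / 4 + arctan (17 / 1617)"
    using arctan_shift_one[of "17 / 1617"] by simp
  have 2: "arctan 1.02135 = pi / 4 + arctan (427 / 40427)"
    using arctan_shift_one[of "427 / 40427"] by simp
  have "arctan (17 / 1617) \<ge> 17 / 1617 - (17/1617)^3 / 3"
    using arctan_lower_bound[of "17/1617" 1] by (simp add: eval_nat_numeral)
  then have "arctan 1.02125 \<ge> 0.79591088"
    unfolding 1 using pi_approx(1) by (simp add: eval_nat_numeral)
  then show "varphi 1.02125 > 0"
    unfolding varphi_def by (simp add: eval_nat_numeral)
  have "arctan (427 / 40427) \<le> 427 / 40427"
    by (rule arctan_le_self) simp
  then have "arctan 1.02135 \<le> 0.7959607"
    unfolding 2 using pi_approx(2) by simp
  then show "varphi 1.02135 < 0"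
    unfolding varphi_def by (simp add: eval_nat_numeral)
qed

text \<open>
  The sign of the derivative is that of \<open>s\<^sup>4 - 16 s\<^sup>2 + 9\<close>, a quadratic in \<open>s\<^sup>2\<close> with the roots
  \<open>8 - sqrt 55\<close>, between \<open>0\<close> and \<open>1\<close>, and \<open>8 + sqrt 55 > 3\<close>.
\<close>
lemma soliton_quot_unimodal:
  obtains c where "0 < c" "c < 1"
    and "\<And>x y. 0 \<le> x \<Longrightarrow> x < y \<Longrightarrow> y \<le> c \<Longrightarrow> soliton_quot x < soliton_quot y"
    and "\<And>x y. c \<le> x \<Longrightarrow> x < y \<Longrightarrow> y\<^sup>2 < 3 \<Longrightarrow> soliton_quot y < soliton_quot x"
proof
  define r where "r = 8 - sqrt 55"
  define c where "c = sqrt r"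
  have "sqrt 55 < 8" "sqrt 55 > 7"
    by (simp_all add: real_less_lsqrt real_less_rsqrt)
  then have r: "0 < r" "r < 1"
    by (simp_all add: r_def)
  then show c01: "0 < c" "c < 1"
    by (simp_all add: c_def)
  have c2: "c\<^sup>2 = r"
    using r by (simp add: c_def)
  have fact: "s ^ 4 - 16 * s\<^sup>2 + 9 = (s\<^sup>2 - r) * (s\<^sup>2 - (16 - r))" for s
  proof -
    have "r * (16 - r) = 9"
      by (simp add: r_def algebra_simps flip: power2_eq_square)
    moreover have "(s\<^sup>2 - r) * (s\<^sup>2 - (16 - r)) = s ^ 4 - 16 * s\<^sup>2 + r * (16 - r)"
      by algebra
    ultimately show ?thesis by simp
  qed
  show "soliton_quot x < soliton_quot y" if "0 \<le> x" "x < y" "y \<le> c" for x y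
  proof (rule DERIV_pos_imp_increasing_open[OF \<open>x < y\<close>])
    show "\<exists>d. (soliton_quot has_real_derivative d) (at z) \<and> 0 < d" if z: "x < z" "z < y" for z
    proof -
      have "z\<^sup>2 < r"
        using z \<open>0 \<le> x\<close> \<open>y \<le> c\<close> c2 power_strict_mono[of z c 2] by simp
      then have "8 * z\<^sup>2 * (z ^ 4 - 16 * z\<^sup>2 + 9) / (9 * ((3 - z\<^sup>2) * (1 + z\<^sup>2))\<^sup>2) > 0"
        unfolding fact using r z \<open>0 \<le> x\<close>
        by (intro divide_pos_pos mult_pos_pos mult_neg_neg zero_less_power) (auto intro: add_pos_nonneg)
      then show ?thesis
        using soliton_quot_deriv[of z] \<open>z\<^sup>2 < r\<close> r by auto
    qed
    show "continuous_on {x..y} soliton_quot"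
    proof (rule DERIV_atLeastAtMost_imp_continuous_on)
      fix z assume z: "x \<le> z" "z \<le> y"
      then have "z\<^sup>2 \<le> r"
        using \<open>0 \<le> x\<close> \<open>y \<le> c\<close> c2 power_mono[of z c 2] by simp
      then show "\<exists>d. (soliton_quot has_real_derivative d) (at z)"
        using soliton_quot_deriv[of z] r by auto
    qed
  qed
  show "soliton_quot y < soliton_quot x" if "c \<le> x" "x < y" "y\<^sup>2 < 3" for x y
  proof (rule DERIV_neg_imp_decreasing_open[OF \<open>x < y\<close>])
    have sq: "z\<^sup>2 < 3" if "x \<le> z" "z \<le> y" for z
    proof -
      have "0 \<le> z"
        using that \<open>c \<le> x\<close> c01 by linarith
      then show ?thesis
        using power_mono[OF that(2), of 2] \<open>y\<^sup>2 < 3\<close> by linarith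
    qed
    show "\<exists>d. (soliton_quot has_real_derivative d) (at z) \<and> d < 0" if z: "x < z" "z < y" for z
    proof -
      have z2: "z\<^sup>2 > r"
        using z \<open>c \<le> x\<close> c01 c2 power_strict_mono[of c z 2] by simp
      have z3: "z\<^sup>2 < 3"
        using sq z by simp
      have "8 * z\<^sup>2 * ((z\<^sup>2 - r) * (z\<^sup>2 - (16 - r))) / (9 * ((3 - z\<^sup>2) * (1 + z\<^sup>2))\<^sup>2) < 0"
        using r z c01 z2 z3 \<open>c \<le> x\<close>
        by (intro divide_neg_pos mult_pos_neg mult_pos_pos zero_less_power) (auto intro: add_pos_nonneg)
      then show ?thesis
        using soliton_quot_deriv[of z] z3 unfolding fact by auto
    qed
    show "continuous_on {x..y} soliton_quot"
    proof (rule DERIV_atLeastAtMost_imp_continuous_on)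
      fix z assume "x \<le> z" "z \<le> y"
      then show "\<exists>d. (soliton_quot has_real_derivative d) (at z)"
        using soliton_quot_deriv[of z] sq by force
    qed
  qed
qed

text \<open>
  Up to the maximum \<open>c\<close> the quotient is positive because it increases from \<open>0\<close>. To the right of
  \<open>c\<close> it decreases, so its sign at one point passes to the points on the appropriate side: a
  positive value to the left, a nonpositive value, now strictly negative, to the right.
\<close>
lemma varphi_sign:
  assumes "0 < s"
  shows "s \<le> 1.02125 \<Longrightarrow> varphi s > 0" and "s \<ge> 1.02135 \<Longrightarrow> varphi s < 0"
    and "\<lbrakk>1.02125 \<le> s; s < t; varphi s = 0\<rbrakk> \<Longrightarrow> varphi t < 0"
proof -
  obtain c where c: "0 < c" "c < 1"
    and up: "\<And>x y. 0 \<le> x \<Longrightarrow> x < y \<Longrightarrow> y \<le> c \<Longrightarrow> soliton_quot x < soliton_quot y"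
    and down: "\<And>x y. c \<le> x \<Longrightarrow> x < y \<Longrightarrow> y\<^sup>2 < 3 \<Longrightarrow> soliton_quot y < soliton_quot x"
    by (rule soliton_quot_unimodal) blast
  have sgn: "varphi x > 0 \<longleftrightarrow> soliton_quot x > 0" "varphi x < 0 \<longleftrightarrow> soliton_quot x < 0" if "x\<^sup>2 < 3" for x
  proof -
    have "3 * (3 - x\<^sup>2) * (1 + x\<^sup>2) > 0"
      using that by (intro mult_pos_pos) (auto intro: add_pos_nonneg)
    then show "varphi x > 0 \<longleftrightarrow> soliton_quot x > 0" "varphi x < 0 \<longleftrightarrow> soliton_quot x < 0"
      using varphi_eq_soliton_quot[of x] that by (auto simp: zero_less_mult_iff mult_less_0_iff)
  qed
  (* beyond the pole of the quotient *)
  have big: "varphi x < 0" if "x > 0" "x\<^sup>2 \<ge> 3" for x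
  proof -
    have "(3 - x\<^sup>2) * (1 + x\<^sup>2) \<le> 0"
      using that by (intro mult_nonpos_nonneg) auto
    moreover have "9 + 6 * x\<^sup>2 - 3 * x ^ 4 = 3 * ((3 - x\<^sup>2) * (1 + x\<^sup>2))"
      by algebra
    ultimately have "9 + 6 * x\<^sup>2 - 3 * x ^ 4 \<le> 0"
      by linarith
    then have "(9 + 6 * x\<^sup>2 - 3 * x ^ 4) * arctan x \<le> 0"
      using that by (intro mult_nonpos_nonneg) (auto simp: zero_le_arctan_iff)
    moreover have "x ^ 3 > 0"
      using that by simp
    ultimately show ?thesis
      unfolding varphi_def using \<open>x > 0\<close> by linarith
  qed
  (* once nonpositive to the right of the maximum, varphi stays negative *)
  have drop: "varphi t < 0" if "c \<le> s" "s < t" "varphi s \<le> 0" "s\<^sup>2 < 3" for s t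
  proof (cases "t\<^sup>2 < 3")
    case True
    then show ?thesis
      using down[OF that(1,2)] sgn[of s] sgn[of t] that by force
  qed (use big that c in auto)
  show "varphi s > 0" if "s \<le> 1.02125"
  proof (cases "s \<le> c")
    case True
    have "soliton_quot 0 = 0"
      by (simp add: soliton_quot_def)
    then have "soliton_quot s > 0"
      using up[of 0 s] assms True by simp
    moreover have "s\<^sup>2 < 3"
      using True c assms power_mono[of s 1 2] by simp
    ultimately show ?thesis
      using sgn by simp
  next
    case False
    have "s\<^sup>2 < 3"
      using that assms power_mono[of s "1.02125" 2] by (simp add: power2_eq_square)
    then show ?thesis
      using drop[of s "1.02125"] False that varphi_bracket(1) by (cases "s = 1.02125") force+
  qed
  show "varphi s < 0" if "s \<ge> 1.02135"
  proof (cases "s = 1.02135")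
    case True
    then show ?thesis
      using varphi_bracket(2) by (simp only:)
  next
    case False
    then show ?thesis
      using drop[of "1.02135" s] that varphi_bracket(2) c by (simp add: power2_eq_square)
  qed
  show "varphi t < 0" if "1.02125 \<le> s" "s < t" "varphi s = 0"
    using drop[of s t] that c big[of s] by force
qed

lemma varphi_unique_zero: "\<exists>!s. 0 < s \<and> varphi s = 0"
proof (rule ex_ex1I)
  have "\<exists>s\<ge>1.02125. s \<le> 1.02135 \<and> varphi s = 0"
    by (rule IVT2') (use varphi_bracket in \<open>auto simp: varphi_def intro!: continuous_intros\<close>)
  then obtain s where "1.02125 \<le> s" "varphi s = 0"
    by blast
  then show "\<exists>s. 0 < s \<and> varphi s = 0"
    by (intro exI[of _ s]) simp
  show "s = t" if "0 < s \<and> varphi s = 0" "0 < t \<and> varphi t = 0" for s t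
  proof -
    have "1.02125 \<le> x" if "0 < x" "varphi x = 0" for x
      using varphi_sign(1)[OF that(1)] that(2) by (cases "x \<le> 1.02125") auto
    then have "1.02125 \<le> s" "1.02125 \<le> t"
      using that by blast+
    then show ?thesis
      using varphi_sign(3)[of s t] varphi_sign(3)[of t s] that by (cases s t rule: linorder_cases) auto
  qed
qed

lemma varphi_neg_after_zero:
  assumes "0 < sbar" "varphi sbar = 0"
  shows "\<bar>sbar - 1.0213\<bar> < 0.00005" and "s > sbar \<Longrightarrow> varphi s < 0"
proof -
  have "1.02125 < sbar" "sbar < 1.02135"
    using varphi_sign(1,2)[OF assms(1)] assms(2) by force+
  then show "\<bar>sbar - 1.0213\<bar> < 0.00005"
    unfolding abs_less_iff by simp
  show "s > sbar \<Longrightarrow> varphi s < 0"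
    using varphi_sign(3)[OF assms(1), of s] assms(2) \<open>1.02125 < sbar\<close> by simp
qed

section \<open>Instability of long strips\<close>

text \<open>
  Squaring \<open>L0 s0 < L\<close> gives \<open>64 \<pi>\<^sup>2 s0^5 < 15 L\<^sup>2 (- varphi s0)\<close>, which is the second claim after
  multiplication with \<open>15 L\<^sup>2\<close>.
\<close>
lemma L0_threshold:
  assumes "0 < s0" "varphi s0 < 0" "L0 s0 < L"
  shows "0 < L" "varphi s0 + (2 * pi / L)\<^sup>2 * (16 / 15 * s0 ^ 5) < 0"
proof -
  define K where "K = - varphi s0"
  have K: "K > 0"
    using assms by (simp add: K_def)
  have L0: "L0 s0 = 8 * pi * s0 powr (5 / 2) * (15 * K) powr (- 1 / 2)"
  proof -
    have "s0 ^ 3 / 3 + 9 * s0 - (9 + 6 * s0\<^sup>2 - 3 * s0 ^ 4) * arctan s0 = K"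
      by (simp add: K_def varphi_def)
    then show ?thesis
      by (simp only: L0_def)
  qed
  have pos: "L0 s0 > 0"
    using assms(1) K by (simp add: L0)
  then show L: "0 < L"
    using assms(3) by simp
  have "(s0 powr (5 / 2))\<^sup>2 = s0 ^ 5"
    using assms(1) by (simp add: power2_eq_square powr_numeral flip: powr_add)
  moreover have "((15 * K) powr (- 1 / 2))\<^sup>2 = 1 / (15 * K)"
    using K by (simp add: power2_eq_square powr_minus_divide flip: powr_add)
  ultimately have "(L0 s0)\<^sup>2 = 64 * pi\<^sup>2 * s0 ^ 5 / (15 * K)"
    by (simp add: L0 power_mult_distrib)
  moreover have "(L0 s0)\<^sup>2 < L\<^sup>2"
    using pos assms(3) by (intro power_strict_mono) auto
  ultimately have "64 * pi\<^sup>2 * s0 ^ 5 < L\<^sup>2 * (15 * K)"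
    using K by (simp add: pos_divide_less_eq)
  then have "(2 * pi / L)\<^sup>2 * (16 / 15 * s0 ^ 5) < K"
    using L by (simp add: power_divide power_mult_distrib field_simps)
  then show "varphi s0 + (2 * pi / L)\<^sup>2 * (16 / 15 * s0 ^ 5) < 0"
    by (simp add: K_def)
qed

lemma unstable_Sigma:
  assumes "0 < s0" "varphi s0 < 0" "L0 s0 < L"
  shows "unstable e3 (Sigma_dom s0 L) Psi Psi_normal"
proof -
  note L = L0_threshold[OF assms]
  have "Q_phi e3 (Sigma_dom s0 L) Psi Psi_normal (unstable_mode s0 L) < 0"
    unfolding Q_phi_unstable_mode[OF assms(1) L(1)] using L by (intro mult_pos_neg) auto
  then show ?thesis
    unfolding unstable_def stable_def
    using smooth_nearI[OF smooth_unstable_mode] unstable_mode_frontier[OF L(1)]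
      unstable_mode_mean_zero[OF L(1)]
    by (metis not_le)
qed

theorem theorem4p4:
  shows "(\<exists>!s. 0 < s \<and> varphi s = 0) \<and>
    (\<forall>sbar. 0 < sbar \<and> varphi sbar = 0 \<longrightarrow>
       \<bar>sbar - 1.0213\<bar> < 0.00005 \<and>
       (\<forall>s0 L. s0 > sbar \<and> L > L0 s0 \<longrightarrow>
          translating_soliton 1 e3 (Sigma_dom s0 L) Psi Psi_normal \<and>
          unstable e3 (Sigma_dom s0 L) Psi Psi_normal))"
proof (intro conjI allI impI)
  show "\<exists>!s. 0 < s \<and> varphi s = 0"
    by (rule varphi_unique_zero)
next
  fix sbar :: real
  assume sbar: "0 < sbar \<and> varphi sbar = 0"
  then show "\<bar>sbar - 1.0213\<bar> < 0.00005"
    using varphi_neg_after_zero(1) by blast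
  fix s0 L :: real
  assume s0L: "s0 > sbar \<and> L > L0 s0"
  then have "0 < s0" "varphi s0 < 0"
    using sbar varphi_neg_after_zero(2)[of sbar s0] by auto
  then show "translating_soliton 1 e3 (Sigma_dom s0 L) Psi Psi_normal"
    and "unstable e3 (Sigma_dom s0 L) Psi Psi_normal"
    using s0L L0_threshold(1) translating_soliton_Sigma unstable_Sigma by blast+
qed

end
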